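(* Let $\Omega$ be a set, and let $\mathcal{P}$ denote the pointwise topology on $\Omega^\Omega$. Suppose that $\Omega^\Omega$ is a semitopological semigroup with respect to a $T_1$ topology $\mathcal{T}$, and that $\mathcal{T}$ induces a topology on $\mathrm{Sym}(\Omega)$ that is contained in the pointwise topology on $\mathrm{Sym}(\Omega)$. Then $\mathcal{T}=\mathcal{P}$.
   Context: $\Omega^\Omega$ is the monoid of all functions $\Omega\to\Omega$ under composition, and $\mathrm{Sym}(\Omega)\subseteq\Omega^\Omega$ is the group of all permutations of $\Omega$. The pointwise topology on $\Omega^\Omega$ is the product topology on $\prod_\Omega\Omega$ with each factor $\Omega$ discrete; the pointwise topology on $\mathrm{Sym}(\Omega)$ is the subspace topology it induces. A semigroup $S$ with a topology is semitopological if for every $s\in S$ the maps $x\mapsto xs$ and $x\mapsto sx$ are continuous maps $S\to S$. *)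

theory Defs
  imports "HOL-Analysis.Analysis" "HOL-Algebra.Bij"
begin

text \<open>
  The set \<open>\<Omega>\<close> is an arbitrary (possibly empty) set over a type. A function \<open>\<Omega> \<Rightarrow> \<Omega>\<close> is represented
  by its extensional version, so that each one has exactly one representative in \<open>\<Omega> \<rightarrow>\<^sub>E \<Omega>\<close>.
\<close>

definition full_transformation_monoid :: "'a set \<Rightarrow> ('a \<Rightarrow> 'a) monoid" where
  "full_transformation_monoid \<Omega> =
    \<lparr>carrier = \<Omega> \<rightarrow>\<^sub>E \<Omega>, monoid.mult = (\<lambda>f g. compose \<Omega> f g), one = (\<lambda>x\<in>\<Omega>. x)\<rparr>"

lemma monoid_full_transformation_monoid: "monoid (full_transformation_monoid \<Omega>)"
proof (rule monoidI)
  fix f g h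
  assume "h \<in> carrier (full_transformation_monoid \<Omega>)"
  then show "(f \<otimes>\<^bsub>full_transformation_monoid \<Omega>\<^esub> g) \<otimes>\<^bsub>full_transformation_monoid \<Omega>\<^esub> h =
    f \<otimes>\<^bsub>full_transformation_monoid \<Omega>\<^esub> (g \<otimes>\<^bsub>full_transformation_monoid \<Omega>\<^esub> h)"
    by (auto simp: full_transformation_monoid_def compose_def fun_eq_iff PiE_def Pi_def)
qed (auto simp: full_transformation_monoid_def compose_def fun_eq_iff PiE_def Pi_def extensional_def)

text \<open>The permutations of \<open>\<Omega>\<close>, as a subset of \<open>\<Omega> \<rightarrow>\<^sub>E \<Omega>\<close>, are the library's \<^const>\<open>Bij\<close>.\<close>

lemma Bij_subset_full_transformation_monoid: "Bij \<Omega> \<subseteq> carrier (full_transformation_monoid \<Omega>)"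
  by (auto simp: full_transformation_monoid_def Bij_def bij_betw_def PiE_def)

definition pointwise_topology :: "'a set \<Rightarrow> ('a \<Rightarrow> 'a) topology" where
  "pointwise_topology \<Omega> = product_topology (\<lambda>_. discrete_topology \<Omega>) \<Omega>"

lemma topspace_pointwise_topology:
  "topspace (pointwise_topology \<Omega>) = carrier (full_transformation_monoid \<Omega>)"
  by (simp add: pointwise_topology_def full_transformation_monoid_def)

text \<open>Only the carrier and the multiplication of the record are used; \<open>one\<close> plays no role.\<close>

definition semitopological_semigroup :: "('a, 'b) monoid_scheme \<Rightarrow> 'a topology \<Rightarrow> bool" where
  "semitopological_semigroup S T \<longleftrightarrow>
    topspace T = carrier S \<and>
    (\<forall>x\<in>carrier S. \<forall>y\<in>carrier S. x \<otimes>\<^bsub>S\<^esub> y \<in> carrier S) \<and>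
    (\<forall>x\<in>carrier S. \<forall>y\<in>carrier S. \<forall>z\<in>carrier S.
      (x \<otimes>\<^bsub>S\<^esub> y) \<otimes>\<^bsub>S\<^esub> z = x \<otimes>\<^bsub>S\<^esub> (y \<otimes>\<^bsub>S\<^esub> z)) \<and>
    (\<forall>s\<in>carrier S. continuous_map T T (\<lambda>x. x \<otimes>\<^bsub>S\<^esub> s) \<and> continuous_map T T (\<lambda>x. s \<otimes>\<^bsub>S\<^esub> x))"

end

theory Submission
  imports Defs
begin

text \<open>
  Write \<open>c\<^sub>a\<close> for the constant map with value \<open>a\<close>, and let \<open>g\<close> send \<open>b\<close> to some \<open>c \<noteq> b\<close> and every
  other point to \<open>b\<close>. Then \<open>{f. f a \<noteq> b} = {f. g \<circ> f \<circ> c\<^sub>a = c\<^sub>b}\<close> is the preimage of a point under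
  translations, hence \<open>\<T>\<close>-closed, so \<open>\<T>\<close> contains the pointwise topology.

  Conversely, for infinite \<open>\<Omega>\<close> identified with \<open>\<Omega> \<times> \<Omega>\<close>, let \<open>\<beta>\<close> be the first projection and
  \<open>\<alpha> x = (x, a)\<close>. Then \<open>p \<mapsto> \<beta> \<circ> p \<circ> \<alpha>\<close> maps the permutations onto all self-maps, and it is open for
  the pointwise topologies: if \<open>\<beta> \<circ> p \<circ> \<alpha>\<close> and \<open>g\<close> agree at every \<open>x\<close> with \<open>\<alpha> x\<close> in a finite set \<open>F\<close>,
  then \<open>g = \<beta> \<circ> q \<circ> \<alpha>\<close> for a permutation \<open>q\<close> agreeing with \<open>p\<close> on \<open>F\<close>. Since this map is also
  \<open>\<T>\<close>-continuous, \<open>\<T>\<close>-open sets are images of pointwise open sets of permutations.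
\<close>

section \<open>Cardinality and the extension of injections to permutations\<close>

text \<open>Points are removed one at a time: what remains of \<open>B\<close> is still infinite, so
  putting a single point back does not raise its cardinality.\<close>

lemma lepoll_Diff_finite:
  assumes "A \<lesssim> B" "infinite A" "finite F"
  shows "A \<lesssim> B - F"
  using \<open>finite F\<close>
proof induction
  case empty
  then show ?case using assms by simp
next
  case (insert x F)
  have "infinite (B - insert x F)"
    using assms(1,2) insert.hyps(1)
    by (metis finite_Diff2 finite_insert infinite_le_lepoll lepoll_trans)
  then have "insert x (B - insert x F) \<lesssim> B - insert x F"
    by (rule infinite_insert_lepoll)
  moreover have "B - F \<lesssim> insert x (B - insert x F)"
    by (rule subset_imp_lepoll) blast
  ultimately have "B - F \<lesssim> B - insert x F"
    using lepoll_trans by blast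
  then show ?case
    using insert.IH lepoll_trans by blast
qed

lemma infinite_Times_self_bij:
  assumes "infinite A"
  obtains k where "bij_betw k (A \<times> A) A"
  using card_of_Times_same_infinite[OF assms] card_of_ordIso by metis

text \<open>The last two assumptions make the complements of the domain and of the range of
  \<open>r\<close> equally large, so a bijection between them completes \<open>r\<close> to a
  permutation.\<close>

lemma inj_on_extends_to_Bij:
  assumes "inj_on r D" "D \<subseteq> \<Omega>" "r ` D \<subseteq> \<Omega>" "\<Omega> \<lesssim> \<Omega> - D" "\<Omega> \<lesssim> \<Omega> - r ` D"
  obtains q where "q \<in> Bij \<Omega>" "\<forall>x\<in>D. q x = r x"
proof -
  have "\<Omega> - D \<approx> \<Omega> - r ` D"
    \<comment> \<open>Schroeder-Bernstein: each complement lies in \<Omega>, and \<Omega> embeds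
      into the other one.\<close>
    by (meson assms(4,5) Diff_subset lepoll_antisym lepoll_trans subset_imp_lepoll)
  then obtain s where s: "bij_betw s (\<Omega> - D) (\<Omega> - r ` D)"
    unfolding eqpoll_def by blast
  define q where "q = (\<lambda>x\<in>\<Omega>. if x \<in> D then r x else s x)"
  have "bij_betw q D (r ` D)"
    using assms(1,2) by (subst bij_betw_cong[where g = r]) (auto simp: q_def bij_betw_def)
  moreover have "bij_betw q (\<Omega> - D) (\<Omega> - r ` D)"
    using s by (subst bij_betw_cong[where g = s]) (auto simp: q_def)
  ultimately have "bij_betw q (D \<union> (\<Omega> - D)) (r ` D \<union> (\<Omega> - r ` D))"
    by (rule bij_betw_combine) blast
  moreover have "D \<union> (\<Omega> - D) = \<Omega>" "r ` D \<union> (\<Omega> - r ` D) = \<Omega>"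
    using assms(2,3) by auto
  ultimately have "q \<in> Bij \<Omega>"
    by (simp add: Bij_def q_def)
  then show thesis
    using that assms(2) by (force simp: q_def)
qed

section \<open>Lifting self-maps to permutations\<close>

text \<open>With \<open>F\<close> empty this is surjectivity of the map taking \<open>p\<close> to
  \<beta> o p o \<alpha>; with general \<open>F\<close> it is openness. The first coordinates of the
  values of \<open>q\<close> are dictated by \<open>g\<close>, while the second coordinates are free
  and are used to make \<open>q\<close> injective.\<close>

lemma Bij_factorization:
  assumes "infinite \<Omega>"
  obtains \<alpha> \<beta> where "\<alpha> \<in> \<Omega> \<rightarrow>\<^sub>E \<Omega>" "\<beta> \<in> \<Omega> \<rightarrow>\<^sub>E \<Omega>" "inj_on \<alpha> \<Omega>"
    "\<forall>p\<in>Bij \<Omega>. \<forall>g\<in>\<Omega> \<rightarrow>\<^sub>E \<Omega>. \<forall>F. finite F \<and> F \<subseteq> \<Omega> \<and>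
        (\<forall>x\<in>\<Omega>. \<alpha> x \<in> F \<longrightarrow> \<beta> (p (\<alpha> x)) = g x)
      \<longrightarrow> (\<exists>q\<in>Bij \<Omega>. (\<forall>x\<in>F. q x = p x) \<and> (\<forall>x\<in>\<Omega>. \<beta> (q (\<alpha> x)) = g x))"
proof -
  obtain k where k: "bij_betw k (\<Omega> \<times> \<Omega>) \<Omega>"
    using infinite_Times_self_bij[OF assms] .
  obtain a where a: "a \<in> \<Omega>"
    using assms by fastforce
  \<comment> \<open>The slice with second coordinate \<open>a\<close> will be the range of \<alpha>;
    the slice at \<open>b\<close> supplies \<Omega>-many points outside that range.\<close>
  obtain b where b: "b \<in> \<Omega>" "b \<noteq> a"
    using assms by (metis finite.simps insertCI subsetI subset_singletonD)
  define \<pi>1 where "\<pi>1 = (\<lambda>z. fst (inv_into (\<Omega> \<times> \<Omega>) k z))"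
  define \<pi>2 where "\<pi>2 = (\<lambda>z. snd (inv_into (\<Omega> \<times> \<Omega>) k z))"
  have kin: "k (x, y) \<in> \<Omega>" and pi1k: "\<pi>1 (k (x, y)) = x" and pi2k: "\<pi>2 (k (x, y)) = y"
    if "x \<in> \<Omega>" "y \<in> \<Omega>" for x y
    using that k bij_betw_inv_into_left[OF k, of "(x, y)"]
    by (auto simp: \<pi>1_def \<pi>2_def bij_betw_def)
  have pi1in: "\<pi>1 z \<in> \<Omega>" if "z \<in> \<Omega>" for z
    using that bij_betwE[OF bij_betw_inv_into[OF k]] by (auto simp: \<pi>1_def mem_Times_iff)
  define \<alpha> where "\<alpha> = (\<lambda>x\<in>\<Omega>. k (x, a))"
  define \<beta> where "\<beta> = (\<lambda>z\<in>\<Omega>. \<pi>1 z)"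
  show thesis
  proof
    show "\<alpha> \<in> \<Omega> \<rightarrow>\<^sub>E \<Omega>" "\<beta> \<in> \<Omega> \<rightarrow>\<^sub>E \<Omega>"
      using kin a pi1in by (auto simp: \<alpha>_def \<beta>_def)
    show "inj_on \<alpha> \<Omega>"
      using pi1k a by (metis (no_types, lifting) \<alpha>_def inj_onI restrict_apply')
    show "\<forall>p\<in>Bij \<Omega>. \<forall>g\<in>\<Omega> \<rightarrow>\<^sub>E \<Omega>. \<forall>F. finite F \<and> F \<subseteq> \<Omega> \<and>
        (\<forall>x\<in>\<Omega>. \<alpha> x \<in> F \<longrightarrow> \<beta> (p (\<alpha> x)) = g x)
      \<longrightarrow> (\<exists>q\<in>Bij \<Omega>. (\<forall>x\<in>F. q x = p x) \<and> (\<forall>x\<in>\<Omega>. \<beta> (q (\<alpha> x)) = g x))"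
    proof (intro ballI allI impI, elim conjE)
      fix p g F
      assume p: "p \<in> Bij \<Omega>" and g: "g \<in> \<Omega> \<rightarrow>\<^sub>E \<Omega>" and F: "finite F" "F \<subseteq> \<Omega>"
        and agree: "\<forall>x\<in>\<Omega>. \<alpha> x \<in> F \<longrightarrow> \<beta> (p (\<alpha> x)) = g x"
      have pinj: "inj_on p \<Omega>"
        using p by (simp add: Bij_def bij_betw_def)
      have pin: "p x \<in> \<Omega>" if "x \<in> \<Omega>" for x
        using Bij_imp_funcset[OF p] that by (rule funcset_mem)
      have gin: "g x \<in> \<Omega>" if "x \<in> \<Omega>" for x
        using g that by (rule PiE_mem)
      \<comment> \<open>\<gamma> will provide the second coordinates of the new values: distinct for
        distinct points, and different from those of all values of \<open>p\<close> on
        \<open>F\<close>.\<close>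
      have "\<Omega> \<lesssim> \<Omega> - \<pi>2 ` p ` F"
        using lepoll_Diff_finite[OF lepoll_refl assms] F(1) by simp
      then obtain \<gamma> where \<gamma>: "inj_on \<gamma> \<Omega>" "\<gamma> ` \<Omega> \<subseteq> \<Omega> - \<pi>2 ` p ` F"
        unfolding lepoll_def by blast
      have \<gamma>in: "\<gamma> x \<in> \<Omega>" and \<gamma>F: "\<And>z. z \<in> F \<Longrightarrow> \<pi>2 (p z) \<noteq> \<gamma> x" if "x \<in> \<Omega>" for x
        using \<gamma>(2) that by force+
      have pi1\<alpha>: "\<pi>1 (\<alpha> x) = x" "\<alpha> x \<in> \<Omega>" if "x \<in> \<Omega>" for x
        using that a pi1k kin by (auto simp: \<alpha>_def)
      \<comment> \<open>The partial map to be extended: it keeps \<open>p\<close> on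
        \<open>F\<close> and sends every other \<alpha> x to the point with coordinates
        \<open>g x\<close> and \<open>\<gamma> x\<close>, which \<beta> maps to
        \<open>g x\<close>.\<close>
      define r where "r = (\<lambda>z. if z \<in> F then p z else k (g (\<pi>1 z), \<gamma> (\<pi>1 z)))"
      define D where "D = F \<union> \<alpha> ` \<Omega>"
      have r\<alpha>: "r (\<alpha> x) = k (g x, \<gamma> x)" if "x \<in> \<Omega>" "\<alpha> x \<notin> F" for x
        using that pi1\<alpha> by (simp add: r_def)
      have rF: "r z = p z" if "z \<in> F" for z
        using that by (simp add: r_def)
      have pi2r: "\<pi>2 (r (\<alpha> x)) = \<gamma> x" if "x \<in> \<Omega>" "\<alpha> x \<notin> F" for x
        using that r\<alpha> pi2k gin \<gamma>in by simp
      have "inj_on r D"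
      proof (rule inj_onI)
        fix u v
        assume uv: "u \<in> D" "v \<in> D" "r u = r v"
        have cases: "w \<in> F \<or> (\<exists>x\<in>\<Omega>. w = \<alpha> x \<and> w \<notin> F)" if "w \<in> D" for w
          using that by (auto simp: D_def)
        consider "u \<in> F" "v \<in> F"
          | x where "u \<in> F" "x \<in> \<Omega>" "v = \<alpha> x" "v \<notin> F"
          | x where "v \<in> F" "x \<in> \<Omega>" "u = \<alpha> x" "u \<notin> F"
          | x y where "x \<in> \<Omega>" "u = \<alpha> x" "u \<notin> F" "y \<in> \<Omega>" "v = \<alpha> y" "v \<notin> F"
          using cases[OF uv(1)] cases[OF uv(2)] by blast
        \<comment> \<open>Both points in \<open>F\<close>: \<open>p\<close> is injective. In the
          mixed cases the second coordinates differ by the choice of \<gamma>, a contradiction. Both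
          points outside \<open>F\<close>: \<gamma> is injective.\<close>
        then show "u = v"
        proof cases
          case 1
          then show ?thesis
            using uv(3) rF pinj F(2) by (metis inj_onD subsetD)
        next
          case 2
          then show ?thesis
            using uv(3) rF \<gamma>F pi2r by metis
        next
          case 3
          then show ?thesis
            using uv(3) rF \<gamma>F pi2r by metis
        next
          case 4
          then show ?thesis
            using uv(3) pi2r \<gamma>(1) by (metis inj_onD)
        qed
      qed
      moreover have "D \<subseteq> \<Omega>"
        using F(2) pi1\<alpha>(2) by (auto simp: D_def)
      moreover have "r ` D \<subseteq> \<Omega>"
        using F(2) pin kin gin \<gamma>in pi1\<alpha> by (auto simp: D_def r_def)
      moreover have "\<Omega> \<lesssim> \<Omega> - D"
      proof -
        \<comment> \<open>The slice at \<open>b\<close> misses the range of \<alpha>; discarding the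
          finite set \<open>F\<close> as well costs no cardinality.\<close>
        have "inj_on (\<lambda>x. k (x, b)) \<Omega>"
          using pi1k b(1) by (intro inj_on_inverseI[where g = \<pi>1]) simp
        moreover have "(\<lambda>x. k (x, b)) ` \<Omega> \<subseteq> \<Omega> - \<alpha> ` \<Omega>"
        proof clarify
          fix x assume x: "x \<in> \<Omega>"
          have "k (x, b) \<noteq> \<alpha> y" if "y \<in> \<Omega>" for y
            using x that pi2k[of x b] pi2k[of y a] a b by (auto simp: \<alpha>_def)
          then show "k (x, b) \<in> \<Omega> - \<alpha> ` \<Omega>"
            using kin x b(1) by blast
        qed
        ultimately have "\<Omega> \<lesssim> \<Omega> - \<alpha> ` \<Omega>"
          unfolding lepoll_def by blast
        from lepoll_Diff_finite[OF this assms F(1)] show ?thesis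
          by (simp add: D_def Diff_eq Int_ac)
      qed
      moreover have "\<Omega> \<lesssim> \<Omega> - r ` D"
      proof -
        \<comment> \<open>A first coordinate that \<open>r\<close> does not use at \<open>x\<close>.
          The points \<open>k (e x, \<gamma> x)\<close> avoid the range of \<open>r\<close>: their
          second coordinates exclude values of \<open>p\<close> on \<open>F\<close>, and equality
          with \<open>k (g y, \<gamma> y)\<close> would force x = y and then
          \<open>e x = g x\<close>.\<close>
        define e where "e = (\<lambda>x. if g x = a then b else a)"
        have e: "e x \<in> \<Omega>" "e x \<noteq> g x" for x
          using a b by (auto simp: e_def)
        have "inj_on (\<lambda>x. k (e x, \<gamma> x)) \<Omega>"
        proof (rule inj_onI)
          fix x y
          assume xy: "x \<in> \<Omega>" "y \<in> \<Omega>" "k (e x, \<gamma> x) = k (e y, \<gamma> y)"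
          then have "\<gamma> x = \<gamma> y"
            using pi2k[OF e(1) \<gamma>in] by metis
          then show "x = y"
            using inj_onD[OF \<gamma>(1)] xy(1,2) by simp
        qed
        moreover have "(\<lambda>x. k (e x, \<gamma> x)) ` \<Omega> \<subseteq> \<Omega> - r ` D"
        proof clarify
          fix x assume x: "x \<in> \<Omega>"
          have not_p: "k (e x, \<gamma> x) \<noteq> p z" if "z \<in> F" for z
            using \<gamma>F[OF x that] pi2k[OF e(1) \<gamma>in[OF x]] by metis
          have not_k: "k (e x, \<gamma> x) \<noteq> k (g y, \<gamma> y)" if y: "y \<in> \<Omega>" for y
          proof
            assume eq: "k (e x, \<gamma> x) = k (g y, \<gamma> y)"
            have "\<gamma> x = \<gamma> y"
              using eq pi2k[OF e(1)[of x] \<gamma>in[OF x]] pi2k[OF gin[OF y] \<gamma>in[OF y]] by simp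
            moreover have "e x = g y"
              using eq pi1k[OF e(1)[of x] \<gamma>in[OF x]] pi1k[OF gin[OF y] \<gamma>in[OF y]] by simp
            ultimately show False
              using inj_onD[OF \<gamma>(1)] x y e(2) by metis
          qed
          have "k (e x, \<gamma> x) \<noteq> r z" if "z \<in> D" for z
            using that not_p[of z] not_k[of "\<pi>1 z"] pi1\<alpha>(1) by (auto simp: D_def r_def)
          then show "k (e x, \<gamma> x) \<in> \<Omega> - r ` D"
            using kin[OF e(1) \<gamma>in[OF x]] by blast
        qed
        ultimately show ?thesis
          unfolding lepoll_def by blast
      qed
      ultimately obtain q where q: "q \<in> Bij \<Omega>" "\<forall>x\<in>D. q x = r x"
        by (rule inj_on_extends_to_Bij)
      have "\<beta> (q (\<alpha> x)) = g x" if x: "x \<in> \<Omega>" for x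
      proof (cases "\<alpha> x \<in> F")
        \<comment> \<open>Here \<open>q\<close> is forced to be \<open>p\<close>, so the value comes
          from the agreement hypothesis.\<close>
        case True
        then show ?thesis
          using agree x q(2) rF by (simp add: D_def)
      next
        case False
        then show ?thesis
          using q(2) r\<alpha>[OF x] x kin pi1k gin \<gamma>in by (simp add: D_def \<beta>_def)
      qed
      moreover have "\<forall>x\<in>F. q x = p x"
        using q(2) rF by (simp add: D_def)
      ultimately show "\<exists>q\<in>Bij \<Omega>. (\<forall>x\<in>F. q x = p x) \<and> (\<forall>x\<in>\<Omega>. \<beta> (q (\<alpha> x)) = g x)"
        using q(1) by blast
    qed
  qed
qed

section \<open>Pointwise neighbourhoods as agreement on finite sets\<close>

lemma openin_pointwise_topology:
  "openin (pointwise_topology \<Omega>) U \<longleftrightarrow>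
    U \<subseteq> \<Omega> \<rightarrow>\<^sub>E \<Omega> \<and>
    (\<forall>f\<in>U. \<exists>F. finite F \<and> F \<subseteq> \<Omega> \<and> (\<forall>g\<in>\<Omega> \<rightarrow>\<^sub>E \<Omega>. (\<forall>x\<in>F. g x = f x) \<longrightarrow> g \<in> U))"
  (is "?L \<longleftrightarrow> ?R")
proof
  assume L: ?L
  have "\<exists>F. finite F \<and> F \<subseteq> \<Omega> \<and> (\<forall>g\<in>\<Omega> \<rightarrow>\<^sub>E \<Omega>. (\<forall>x\<in>F. g x = f x) \<longrightarrow> g \<in> U)" if "f \<in> U" for f
  proof -
    obtain V where V: "finite {i \<in> \<Omega>. V i \<noteq> \<Omega>}" "f \<in> Pi\<^sub>E \<Omega> V" "Pi\<^sub>E \<Omega> V \<subseteq> U"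
      using L \<open>f \<in> U\<close> unfolding pointwise_topology_def openin_product_topology_alt by fastforce
    \<comment> \<open>Only the finitely many coordinates where \<open>V\<close> is a proper
      restriction matter, and there \<open>g\<close> takes the values of \<open>f\<close>.\<close>
    have "g \<in> Pi\<^sub>E \<Omega> V" if "g \<in> \<Omega> \<rightarrow>\<^sub>E \<Omega>" "\<forall>x\<in>{i \<in> \<Omega>. V i \<noteq> \<Omega>}. g x = f x" for g
      using that V(2) by (simp add: PiE_iff) (metis PiE_mem)
    then show ?thesis
      using V(1,3) by (intro exI[of _ "{i \<in> \<Omega>. V i \<noteq> \<Omega>}"]) blast
  qed
  moreover have "U \<subseteq> \<Omega> \<rightarrow>\<^sub>E \<Omega>"
    using openin_subset[OF L] by (simp add: pointwise_topology_def)
  ultimately show ?R by blast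
next
  assume R: ?R
  show ?L
    unfolding pointwise_topology_def openin_product_topology_alt
  proof
    fix f assume f: "f \<in> U"
    then obtain F where F: "finite F" "F \<subseteq> \<Omega>"
      "\<forall>g\<in>\<Omega> \<rightarrow>\<^sub>E \<Omega>. (\<forall>x\<in>F. g x = f x) \<longrightarrow> g \<in> U"
      using R by auto
    have fin: "f \<in> \<Omega> \<rightarrow>\<^sub>E \<Omega>"
      using f R by blast
    define V where "V = (\<lambda>i. if i \<in> F then {f i} else \<Omega>)"
    have "finite {i \<in> \<Omega>. V i \<noteq> \<Omega>}"
      by (rule finite_subset[OF _ F(1)]) (auto simp: V_def)
    moreover have "V i \<subseteq> \<Omega>" if "i \<in> \<Omega>" for i
      using fin that by (auto simp: V_def)
    moreover have "f \<in> Pi\<^sub>E \<Omega> V"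
      using fin by (auto simp: V_def PiE_iff)
    moreover have "g \<in> U" if g: "g \<in> Pi\<^sub>E \<Omega> V" for g
    proof (rule F(3)[rule_format])
      show "g \<in> \<Omega> \<rightarrow>\<^sub>E \<Omega>"
        using g \<open>\<And>i. i \<in> \<Omega> \<Longrightarrow> V i \<subseteq> \<Omega>\<close> by (auto simp: PiE_iff)
      show "g x = f x" if "x \<in> F" for x
        using PiE_mem[OF g, of x] F(2) that by (auto simp: V_def)
    qed
    ultimately show "\<exists>V. finite {i \<in> \<Omega>. V i \<noteq> topspace (discrete_topology \<Omega>)} \<and>
        (\<forall>i\<in>\<Omega>. openin (discrete_topology \<Omega>) (V i)) \<and> f \<in> Pi\<^sub>E \<Omega> V \<and> Pi\<^sub>E \<Omega> V \<subseteq> U"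
      by (intro exI[of _ V]) auto
  qed
qed

lemma openin_pointwise_topologyE:
  assumes "openin (pointwise_topology \<Omega>) U" "f \<in> U"
  obtains F where "finite F" "F \<subseteq> \<Omega>"
    "\<forall>g\<in>\<Omega> \<rightarrow>\<^sub>E \<Omega>. (\<forall>x\<in>F. g x = f x) \<longrightarrow> g \<in> U"
  using assms unfolding openin_pointwise_topology by meson

section \<open>The pointwise topology is contained in \<T>\<close>

lemma openin_point_evaluation:
  fixes \<T> :: "('a \<Rightarrow> 'a) topology"
  assumes S: "semitopological_semigroup (full_transformation_monoid \<Omega>) \<T>"
    and t1: "t1_space \<T>" and a: "a \<in> \<Omega>" and b: "b \<in> \<Omega>"
  shows "openin \<T> {f \<in> \<Omega> \<rightarrow>\<^sub>E \<Omega>. f a = b}"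
\<comment> \<open>On a one-point set there is no \<open>c\<close> different from \<open>b\<close>,
  but then the set in question is the whole space.\<close>
proof (cases "\<Omega> = {b}")
  case True
  then have "{f \<in> \<Omega> \<rightarrow>\<^sub>E \<Omega>. f a = b} = topspace \<T>"
    using S a by (auto simp: semitopological_semigroup_def full_transformation_monoid_def)
  then show ?thesis by simp
next
  case False
  then obtain c where c: "c \<in> \<Omega>" "c \<noteq> b"
    using b by blast
  have top: "topspace \<T> = \<Omega> \<rightarrow>\<^sub>E \<Omega>"
    using S by (simp add: semitopological_semigroup_def full_transformation_monoid_def)
  define const :: "'a \<Rightarrow> 'a \<Rightarrow> 'a" where "const = (\<lambda>y. \<lambda>x\<in>\<Omega>. y)"
  have const: "const y \<in> \<Omega> \<rightarrow>\<^sub>E \<Omega>" if "y \<in> \<Omega>" for y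
    using that by (auto simp: const_def)
  define g where "g = (\<lambda>x\<in>\<Omega>. if x = b then c else b)"
  have g: "g \<in> \<Omega> \<rightarrow>\<^sub>E \<Omega>"
    using b c by (auto simp: g_def)
  have "continuous_map \<T> \<T> (\<lambda>f. compose \<Omega> f (const a))"
    "continuous_map \<T> \<T> (\<lambda>f. compose \<Omega> g f)"
    using S g const[OF a] by (simp_all add: semitopological_semigroup_def full_transformation_monoid_def)
  then have "continuous_map \<T> \<T> (\<lambda>f. compose \<Omega> g (compose \<Omega> f (const a)))"
    using continuous_map_compose[unfolded o_def] by blast
  then have "closedin \<T> {f \<in> topspace \<T>. compose \<Omega> g (compose \<Omega> f (const a)) \<in> {const b}}"
    by (rule closedin_continuous_map_preimage) (simp add: closedin_t1_singleton t1 top const b)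
  moreover have "compose \<Omega> g (compose \<Omega> f (const a)) = const b \<longleftrightarrow> f a \<noteq> b"
    if "f \<in> \<Omega> \<rightarrow>\<^sub>E \<Omega>" for f
  proof -
    have "compose \<Omega> g (compose \<Omega> f (const a)) = const (g (f a))"
      using that by (auto simp: compose_def const_def)
    moreover have "const y = const z \<longleftrightarrow> y = z" for y z
      using a by (auto simp: const_def fun_eq_iff)
    ultimately show ?thesis
      using PiE_mem[OF that a] c by (auto simp: g_def)
  qed
  ultimately have "closedin \<T> {f \<in> \<Omega> \<rightarrow>\<^sub>E \<Omega>. f a \<noteq> b}"
    using top by (simp cong: conj_cong)
  then have "openin \<T> (topspace \<T> - {f \<in> \<Omega> \<rightarrow>\<^sub>E \<Omega>. f a \<noteq> b})"
    by blast
  moreover have "topspace \<T> - {f \<in> \<Omega> \<rightarrow>\<^sub>E \<Omega>. f a \<noteq> b} = {f \<in> \<Omega> \<rightarrow>\<^sub>E \<Omega>. f a = b}"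
    using top by blast
  ultimately show ?thesis by simp
qed

text \<open>Basic pointwise neighbourhoods are finite intersections of the sets from
  \<open>openin_point_evaluation\<close>.\<close>

lemma openin_if_openin_pointwise:
  fixes \<T> :: "('a \<Rightarrow> 'a) topology"
  assumes S: "semitopological_semigroup (full_transformation_monoid \<Omega>) \<T>"
    and t1: "t1_space \<T>" and U: "openin (pointwise_topology \<Omega>) U"
  shows "openin \<T> U"
proof (subst openin_subopen, intro ballI)
  fix f assume "f \<in> U"
  then obtain F where F: "finite F" "F \<subseteq> \<Omega>"
    "\<forall>g\<in>\<Omega> \<rightarrow>\<^sub>E \<Omega>. (\<forall>x\<in>F. g x = f x) \<longrightarrow> g \<in> U"
    using openin_pointwise_topologyE[OF U] by metis
  have fin: "f \<in> \<Omega> \<rightarrow>\<^sub>E \<Omega>"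
    using U \<open>f \<in> U\<close> unfolding openin_pointwise_topology by (meson subsetD)
  have top: "topspace \<T> = \<Omega> \<rightarrow>\<^sub>E \<Omega>"
    using S by (simp add: semitopological_semigroup_def full_transformation_monoid_def)
  have "openin \<T> {g \<in> \<Omega> \<rightarrow>\<^sub>E \<Omega>. \<forall>x\<in>F. g x = f x}"
    using F(1,2)
  proof induction
    case empty
    then show ?case using top openin_topspace[of \<T>] by simp
  next
    case (insert x F)
    have "{g \<in> \<Omega> \<rightarrow>\<^sub>E \<Omega>. \<forall>x\<in>insert x F. g x = f x} =
        {g \<in> \<Omega> \<rightarrow>\<^sub>E \<Omega>. g x = f x} \<inter> {g \<in> \<Omega> \<rightarrow>\<^sub>E \<Omega>. \<forall>x\<in>F. g x = f x}"
      by auto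
    moreover have "openin \<T> {g \<in> \<Omega> \<rightarrow>\<^sub>E \<Omega>. g x = f x}"
      using openin_point_evaluation[OF S t1] insert.prems fin by auto
    ultimately show ?case
      using insert by (simp add: openin_Int)
  qed
  then show "\<exists>T. openin \<T> T \<and> f \<in> T \<and> T \<subseteq> U"
    using F(3) fin by (intro exI[of _ "{g \<in> \<Omega> \<rightarrow>\<^sub>E \<Omega>. \<forall>x\<in>F. g x = f x}"]) auto
qed

section \<open>\<T> is contained in the pointwise topology\<close>

lemma openin_pointwise_if_openin:
  fixes \<T> :: "('a \<Rightarrow> 'a) topology"
  assumes S: "semitopological_semigroup (full_transformation_monoid \<Omega>) \<T>"
    and Sym: "\<And>U. openin (subtopology \<T> (Bij \<Omega>)) U \<Longrightarrow>
           openin (subtopology (pointwise_topology \<Omega>) (Bij \<Omega>)) U"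
    and U: "openin \<T> U"
  shows "openin (pointwise_topology \<Omega>) U"
proof -
  have top: "topspace \<T> = \<Omega> \<rightarrow>\<^sub>E \<Omega>"
    using S by (simp add: semitopological_semigroup_def full_transformation_monoid_def)
  then have sub: "U \<subseteq> \<Omega> \<rightarrow>\<^sub>E \<Omega>"
    using openin_subset[OF U] by simp
  show ?thesis
  proof (cases "finite \<Omega>")
    case True
    \<comment> \<open>For finite \<Omega>, agreement on all of \<Omega> is a finite condition, so
      the pointwise topology is discrete.\<close>
    have "g \<in> U" if "f \<in> U" "g \<in> \<Omega> \<rightarrow>\<^sub>E \<Omega>" "\<forall>x\<in>\<Omega>. g x = f x" for f g
      using that sub by (metis PiE_ext subsetD)
    then show ?thesis
      unfolding openin_pointwise_topology using sub True by blast
  next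
    case False
    obtain \<alpha> \<beta> where \<alpha>: "\<alpha> \<in> \<Omega> \<rightarrow>\<^sub>E \<Omega>" and \<beta>: "\<beta> \<in> \<Omega> \<rightarrow>\<^sub>E \<Omega>"
      and inj: "inj_on \<alpha> \<Omega>"
      and fact: "\<forall>p\<in>Bij \<Omega>. \<forall>g\<in>\<Omega> \<rightarrow>\<^sub>E \<Omega>. \<forall>F. finite F \<and> F \<subseteq> \<Omega> \<and>
        (\<forall>x\<in>\<Omega>. \<alpha> x \<in> F \<longrightarrow> \<beta> (p (\<alpha> x)) = g x)
      \<longrightarrow> (\<exists>q\<in>Bij \<Omega>. (\<forall>x\<in>F. q x = p x) \<and> (\<forall>x\<in>\<Omega>. \<beta> (q (\<alpha> x)) = g x))"
      using Bij_factorization[OF False] .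
    define \<Phi> where "\<Phi> = (\<lambda>p. compose \<Omega> \<beta> (compose \<Omega> p \<alpha>))"
    have \<Phi>_eq: "\<Phi> p = g" if "g \<in> \<Omega> \<rightarrow>\<^sub>E \<Omega>" "\<forall>x\<in>\<Omega>. \<beta> (p (\<alpha> x)) = g x" for p g
      using that by (auto simp: fun_eq_iff \<Phi>_def compose_def PiE_def extensional_def)
    have "continuous_map \<T> \<T> (\<lambda>p. compose \<Omega> p \<alpha>)" "continuous_map \<T> \<T> (\<lambda>p. compose \<Omega> \<beta> p)"
      using S \<alpha> \<beta> by (simp_all add: semitopological_semigroup_def full_transformation_monoid_def)
    then have "continuous_map \<T> \<T> \<Phi>"
      unfolding \<Phi>_def using continuous_map_compose[unfolded o_def] by blast
    then have "openin (subtopology \<T> (Bij \<Omega>)) ({p \<in> topspace \<T>. \<Phi> p \<in> U} \<inter> Bij \<Omega>)"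
      using U openin_continuous_map_preimage openin_subtopology_Int by blast
    \<comment> \<open>The permutations that \<Phi> maps into \<open>U\<close> are the trace of a
      pointwise open set \<open>W\<close>.\<close>
    from Sym[OF this] obtain W where W: "openin (pointwise_topology \<Omega>) W"
      "{p \<in> topspace \<T>. \<Phi> p \<in> U} \<inter> Bij \<Omega> = W \<inter> Bij \<Omega>"
      unfolding openin_subtopology by blast
    have Bij_sub: "Bij \<Omega> \<subseteq> \<Omega> \<rightarrow>\<^sub>E \<Omega>"
      using Bij_subset_full_transformation_monoid[of \<Omega>] by (simp add: full_transformation_monoid_def)
    have WB: "p \<in> W \<longleftrightarrow> \<Phi> p \<in> U" if "p \<in> Bij \<Omega>" for p
      using that W(2) Bij_sub top by blast
    have "\<exists>G. finite G \<and> G \<subseteq> \<Omega> \<and> (\<forall>g\<in>\<Omega> \<rightarrow>\<^sub>E \<Omega>. (\<forall>x\<in>G. g x = f x) \<longrightarrow> g \<in> U)"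
      if f: "f \<in> U" for f
    proof -
      have fin: "f \<in> \<Omega> \<rightarrow>\<^sub>E \<Omega>"
        using f sub by blast
      \<comment> \<open>Surjectivity: starting from the identity permutation with the empty set, the
        agreement condition is vacuous.\<close>
      obtain p where p: "p \<in> Bij \<Omega>" "\<forall>x\<in>\<Omega>. \<beta> (p (\<alpha> x)) = f x"
        using fact[rule_format, OF id_Bij fin, of "{}"] by auto
      then have "p \<in> W"
        using WB \<Phi>_eq[OF fin] f by simp
      then obtain F where F: "finite F" "F \<subseteq> \<Omega>"
        "\<forall>q\<in>\<Omega> \<rightarrow>\<^sub>E \<Omega>. (\<forall>x\<in>F. q x = p x) \<longrightarrow> q \<in> W"
        using openin_pointwise_topologyE[OF W(1)] by metis
      \<comment> \<open>Agreement of \<open>g\<close> with \<open>f\<close> on \<open>G\<close> is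
        exactly what allows \<open>p\<close> to be changed into a preimage of \<open>g\<close>
        without altering it on \<open>F\<close>. Since \<alpha> is injective, \<open>G\<close> is
        finite.\<close>
      define G where "G = {x \<in> \<Omega>. \<alpha> x \<in> F}"
      have "finite G"
        using finite_vimage_IntI[OF F(1) inj] by (simp add: G_def vimage_def Int_def conj_commute)
      moreover have "g \<in> U" if g: "g \<in> \<Omega> \<rightarrow>\<^sub>E \<Omega>" "\<forall>x\<in>G. g x = f x" for g
      proof -
        obtain q where q: "q \<in> Bij \<Omega>" "\<forall>x\<in>F. q x = p x" "\<forall>x\<in>\<Omega>. \<beta> (q (\<alpha> x)) = g x"
          using fact[rule_format, OF p(1) g(1), of F] F(1,2) p(2) g(2) by (auto simp: G_def)
        \<comment> \<open>Agreement with \<open>p\<close> on \<open>F\<close> keeps \<open>q\<close>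
          in \<open>W\<close>, hence its image \<open>g\<close> under \<Phi> in
          \<open>U\<close>.\<close>
        then have "q \<in> W"
          using F(3) Bij_sub by blast
        then show ?thesis
          using WB[OF q(1)] \<Phi>_eq[OF g(1) q(3)] by simp
      qed
      ultimately show ?thesis
        by (intro exI[of _ G]) (auto simp: G_def)
    qed
    then show ?thesis
      unfolding openin_pointwise_topology using sub by blast
  qed
qed

theorem proposition3p3:
  fixes \<Omega> :: "'a set" and \<T> :: "('a \<Rightarrow> 'a) topology"
  assumes "semitopological_semigroup (full_transformation_monoid \<Omega>) \<T>"
    and "t1_space \<T>"
    and "\<forall>U. openin (subtopology \<T> (Bij \<Omega>)) U \<longrightarrow>
           openin (subtopology (pointwise_topology \<Omega>) (Bij \<Omega>)) U"
  shows "\<T> = pointwise_topology \<Omega>"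
  using assms openin_if_openin_pointwise openin_pointwise_if_openin
  by (metis topology_eq)

end
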